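(* Let $(X,\Sigma,m,\tau)$ be an ergodic system that has a fat tower, i.e. there is a set $B\in\Sigma$ with $0<m(B)<1$ such that $\sum_{N\ge 1} N\cdot m(T_N)=\infty$, where $T_N$ denotes the $N$th tower of the Kakutani tower over the base $B$. Then there is a set $A\in\Sigma$ such that, with $f=\mathbf 1_A$ (the indicator function of $A$), $$\sum_{N\ge 1} N\cdot m(E_{f,N})=\infty .$$
   Context: An ergodic system $(X,\Sigma,m,\tau)$ consists of a probability space $(X,\Sigma,m)$ and an invertible, ergodic, $m$-preserving transformation $\tau:X\to X$. For a function $f:X\to\mathbb R$ and $N\ge 1$, the $N$th ergodic average is $$A_Nf(x)=\frac{1}{N}\sum_{n=0}^{N-1} f(\tau^n x).$$ For an integrable $f\ge 0$ and $N\ge 1$, define $$E_{f,N}=\Big\{x\in X: A_Nf(x)>2\int_X f\,dm,\ \text{ and } A_nf(x)\le 2\int_X f\,dm \text{ for all } n>N\Big\}.$$ Kakutani tower: let $B\in\Sigma$ with $0<m(B)<1$. For each integer $N\ge1$, the $N$th first return set of $B$ is $$B_N=\{x\in B:\ \tau^N x\in B \text{ and } \tau^n x\notin B \text{ for } 0<n<N\},$$ and the $N$th tower (possibly empty) is $$T_N=\bigcup_{0\le n<N}\tau^n B_N .$$ The Kakutani tower over the base $B$ is $T=\bigcup_{N\ge 1} T_N$. *)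

theory Defs
  imports "HOL-Probability.Probability"
begin

text \<open>
  Invertibility is understood in the measure-theoretic sense: \<open>\<tau>\<close> is a bijection of the underlying
  space whose inverse is measurable as well.
\<close>

locale ergodic_system = prob_space M for M :: "'a measure" +
  fixes \<tau> :: "'a \<Rightarrow> 'a"
  assumes measurable_transformation: "\<tau> \<in> M \<rightarrow>\<^sub>M M"
    and bij_transformation: "bij_betw \<tau> (space M) (space M)"
    and measurable_inverse: "inv_into (space M) \<tau> \<in> M \<rightarrow>\<^sub>M M"
    and measure_preserving:
      "\<And>A. A \<in> sets M \<Longrightarrow> emeasure M (\<tau> -` A \<inter> space M) = emeasure M A"
    and ergodic:
      "\<And>A. A \<in> sets M \<Longrightarrow> \<tau> -` A \<inter> space M = A \<Longrightarrow> measure M A = 0 \<or> measure M A = 1"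

definition ergodic_average :: "('a \<Rightarrow> 'a) \<Rightarrow> ('a \<Rightarrow> real) \<Rightarrow> nat \<Rightarrow> 'a \<Rightarrow> real" where
  "ergodic_average \<tau> f N x = (1 / real N) * (\<Sum>n<N. f ((\<tau> ^^ n) x))"

definition last_exceedance_set ::
    "'a measure \<Rightarrow> ('a \<Rightarrow> 'a) \<Rightarrow> ('a \<Rightarrow> real) \<Rightarrow> nat \<Rightarrow> 'a set" where
  "last_exceedance_set M \<tau> f N =
    {x \<in> space M. ergodic_average \<tau> f N x > 2 * (\<integral>y. f y \<partial>M) \<and>
       (\<forall>n>N. ergodic_average \<tau> f n x \<le> 2 * (\<integral>y. f y \<partial>M))}"

definition first_return_set :: "('a \<Rightarrow> 'a) \<Rightarrow> 'a set \<Rightarrow> nat \<Rightarrow> 'a set" where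
  "first_return_set \<tau> B N =
    {x \<in> B. (\<tau> ^^ N) x \<in> B \<and> (\<forall>n. 0 < n \<and> n < N \<longrightarrow> (\<tau> ^^ n) x \<notin> B)}"

definition tower :: "('a \<Rightarrow> 'a) \<Rightarrow> 'a set \<Rightarrow> nat \<Rightarrow> 'a set" where
  "tower \<tau> B N = (\<Union>n<N. (\<tau> ^^ n) ` first_return_set \<tau> B N)"

text \<open>
  The series over \<open>N \<ge> 1\<close> are taken in the extended nonnegative reals and indexed by \<open>Suc N\<close>.
\<close>

definition has_fat_tower :: "'a measure \<Rightarrow> ('a \<Rightarrow> 'a) \<Rightarrow> bool" where
  "has_fat_tower M \<tau> \<longleftrightarrow>
    (\<exists>B\<in>sets M. 0 < measure M B \<and> measure M B < 1 \<and>
       (\<Sum>N. of_nat (Suc N) * emeasure M (tower \<tau> B (Suc N))) = \<infinity>)"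

end

theory Submission
  imports Defs
begin

text \<open>
  Let \<open>A\<close> be the union of the towers of height greater than \<open>K\<close>, with \<open>K\<close> so large that
  \<open>m(A) < 1/2\<close>. A point at level \<open>i\<close> of a tower of height \<open>N > K\<close> stays in \<open>A\<close> for the next \<open>N - i\<close>
  steps, so its average over that stretch is \<open>1 > 2 m(A)\<close>. Hence the last exceedance time is at
  least \<open>N - i\<close> there, and its integral over that tower is at least
  \<open>(\<Sum>i<N. (N - i) m(B\<^sub>N)) \<ge> N m(T\<^sub>N) / 2\<close>, which sums to infinity.
  The last exceedance time is finite almost everywhere because, by ergodicity and the maximal ergodic
  argument, the Birkhoff sums of a function with negative integral are almost everywhere bounded
  above.
\<close>

section \<open>Maxima of Birkhoff sums\<close>

text \<open>This is the maximum of the Birkhoff sums of \<open>g\<close> of lengths 0 to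
  \<open>n\<close>, the empty sum 0 included. The recursive form makes the difference between stage
  \<open>Suc n\<close> at x and stage \<open>n\<close> at \<tau> x computable at sight, which is
  what the maximal ergodic argument needs.\<close>

primrec max_birkhoff_sum :: "('a \<Rightarrow> 'a) \<Rightarrow> ('a \<Rightarrow> real) \<Rightarrow> nat \<Rightarrow> 'a \<Rightarrow> real" where
  "max_birkhoff_sum \<tau> g 0 x = 0"
| "max_birkhoff_sum \<tau> g (Suc n) x = max 0 (g x + max_birkhoff_sum \<tau> g n (\<tau> x))"

lemma birkhoff_sum_Suc:
  fixes g :: "'a \<Rightarrow> real"
  shows "(\<Sum>k<Suc n. g ((\<tau> ^^ k) x)) = g x + (\<Sum>k<n. g ((\<tau> ^^ k) (\<tau> x)))"
  by (subst sum.lessThan_Suc_shift) (simp add: funpow_swap1)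

lemma max_birkhoff_sum_nonneg: "0 \<le> max_birkhoff_sum \<tau> g n x"
  by (cases n) auto

lemma max_birkhoff_sum_mono: "max_birkhoff_sum \<tau> g n x \<le> max_birkhoff_sum \<tau> g (Suc n) x"
proof (induction n arbitrary: x)
  case (Suc n)
  have "max_birkhoff_sum \<tau> g (Suc k) x = max 0 (g x + max_birkhoff_sum \<tau> g k (\<tau> x))" for k
    by simp
  with Suc[of "\<tau> x"] show ?case
    by (simp only:)
qed simp

lemma birkhoff_sum_le_max: "(\<Sum>k<n. g ((\<tau> ^^ k) x)) \<le> max_birkhoff_sum \<tau> g n x"
proof (induction n arbitrary: x)
  case (Suc n)
  show ?case
    unfolding birkhoff_sum_Suc using Suc[of "\<tau> x"] by simp
qed simp

section \<open>Combinatorics of the towers\<close>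

text \<open>If the levels differed, cancelling the smaller power of \<tau> would exhibit a base
  point as an intermediate iterate of another base point, that is, a return to \<open>B\<close>
  before the first return time. Equal levels give x = y by injectivity, and a point has only one
  first return time. Disjointness of levels and of towers both follow.\<close>

lemma tower_level_unique:
  assumes \<tau>: "bij_betw \<tau> S S" and "B \<subseteq> S"
    and x: "x \<in> first_return_set \<tau> B N" "i < N"
    and y: "y \<in> first_return_set \<tau> B K" "j < K"
    and eq: "(\<tau> ^^ i) x = (\<tau> ^^ j) y"
  shows "N = K \<and> i = j"
proof -
  have inj: "inj_on (\<tau> ^^ n) S" and maps: "\<And>z. z \<in> S \<Longrightarrow> (\<tau> ^^ n) z \<in> S" for n
    using bij_betw_funpow[OF \<tau>, of n] by (auto simp: bij_betw_def)
  have no_gap: False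
    if "u \<in> first_return_set \<tau> B P" "v \<in> first_return_set \<tau> B Q" "b < Q" "a < b"
      "(\<tau> ^^ a) u = (\<tau> ^^ b) v" for u v P Q a b
  proof -
    have "(\<tau> ^^ b) v = (\<tau> ^^ a) ((\<tau> ^^ (b - a)) v)"
      using that(4) by (simp flip: comp_apply[of "\<tau> ^^ a"] funpow_add)
    moreover have "u \<in> S" "v \<in> S" "u \<in> B"
      using that \<open>B \<subseteq> S\<close> by (auto simp: first_return_set_def)
    ultimately have "u = (\<tau> ^^ (b - a)) v"
      using that(5) inj[of a] maps[of v "b - a"] by (auto dest: inj_onD)
    then show False
      using that \<open>u \<in> B\<close> by (auto simp: first_return_set_def)
  qed
  have "i = j"
    using no_gap[OF x(1) y _ eq] no_gap[OF y(1) x _ eq[symmetric]] by (meson linorder_neqE_nat)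
  moreover have "x \<in> S" "y \<in> S"
    using x y \<open>B \<subseteq> S\<close> by (auto simp: first_return_set_def)
  ultimately have "x = y"
    using eq inj[of i] by (auto dest: inj_onD)
  moreover have "N > 0" "K > 0"
    using x y by auto
  ultimately have "N = K"
    using x(1) y(1) unfolding first_return_set_def by (auto intro: linorder_cases[of N K])
  with \<open>i = j\<close> show ?thesis by simp
qed

text \<open>From level \<open>i\<close> the orbit climbs through levels \<open>i\<close> to
  \<open>N - 1\<close>, all inside \<open>A\<close>, so every summand is 1.\<close>

lemma ergodic_average_tower:
  assumes "y \<in> first_return_set \<tau> B N" "i < N" "tower \<tau> B N \<subseteq> A"
  shows "ergodic_average \<tau> (indicator A) (N - i) ((\<tau> ^^ i) y) = 1"
proof -
  have "indicator A ((\<tau> ^^ k) ((\<tau> ^^ i) y)) = (1::real)" if "k < N - i" for k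
  proof -
    have "(\<tau> ^^ k) ((\<tau> ^^ i) y) = (\<tau> ^^ (k + i)) y"
      by (simp add: funpow_add)
    then have "(\<tau> ^^ k) ((\<tau> ^^ i) y) \<in> tower \<tau> B N"
      using assms(1) that unfolding tower_def by (intro UN_I[of "k + i"]) auto
    then show ?thesis
      using assms(3) by auto
  qed
  then show ?thesis
    using assms(2) by (simp add: ergodic_average_def)
qed

lemma sum_descending_ge: "N * N \<le> 2 * (\<Sum>i<N. N - i)" for N :: nat
proof -
  have "(\<Sum>i<N. N - i) = (\<Sum>i<N. Suc i)"
    by (rule sum.reindex_bij_witness[of _ "\<lambda>i. N - Suc i" "\<lambda>i. N - Suc i"]) auto
  moreover have "2 * (\<Sum>i<N. Suc i) = N * Suc N"
    by (induction N) auto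
  ultimately show ?thesis
    by simp
qed

section \<open>Iterates and images under the transformation\<close>

context ergodic_system
begin

lemma \<tau>_space: "x \<in> space M \<Longrightarrow> \<tau> x \<in> space M"
  using measurable_space[OF measurable_transformation] .

lemma funpow_measurable [measurable]: "(\<tau> ^^ n) \<in> M \<rightarrow>\<^sub>M M"
proof (induction n)
  case (Suc n)
  show ?case
    unfolding funpow.simps by (rule measurable_comp[OF Suc measurable_transformation])
qed (simp add: id_def)

lemma distr_\<tau>: "distr M M \<tau> = M"
  by (rule measure_eqI) (simp_all add: emeasure_distr[OF measurable_transformation] measure_preserving)

lemma sets_image_\<tau>:
  assumes "A \<in> sets M"
  shows "\<tau> ` A \<in> sets M"
proof -
  \<comment> \<open>Turning the forward image into a preimage under the inverse is what brings in
    measurability of the inverse.\<close>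
  have "\<tau> ` A = inv_into (space M) \<tau> -` A \<inter> space M"
  proof (intro set_eqI iffI)
    fix y
    assume "y \<in> \<tau> ` A"
    then obtain x where "x \<in> A" "y = \<tau> x" by blast
    moreover from this have "x \<in> space M"
      using sets.sets_into_space[OF assms] by blast
    ultimately show "y \<in> inv_into (space M) \<tau> -` A \<inter> space M"
      using bij_transformation by (simp add: \<tau>_space bij_betw_def)
  next
    fix y
    assume y: "y \<in> inv_into (space M) \<tau> -` A \<inter> space M"
    then have "\<tau> (inv_into (space M) \<tau> y) = y"
      using bij_betw_inv_into_right[OF bij_transformation] by blast
    with y show "y \<in> \<tau> ` A"
      by (metis IntD1 imageI vimageD)
  qed
  then show ?thesis
    using measurable_sets[OF measurable_inverse assms] by simp
qed

lemma emeasure_image_\<tau>: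
  assumes "A \<in> sets M"
  shows "emeasure M (\<tau> ` A) = emeasure M A"
proof -
  have "\<tau> -` (\<tau> ` A) \<inter> space M = A"
    using bij_transformation sets.sets_into_space[OF assms]
    by (auto simp: bij_betw_def dest: inj_onD)
  then show ?thesis
    using measure_preserving[OF sets_image_\<tau>[OF assms]] by simp
qed

lemma image_funpow:
  assumes "A \<in> sets M"
  shows sets_image_funpow: "(\<tau> ^^ n) ` A \<in> sets M"
    and emeasure_image_funpow: "emeasure M ((\<tau> ^^ n) ` A) = emeasure M A"
proof -
  have "(\<tau> ^^ n) ` A \<in> sets M \<and> emeasure M ((\<tau> ^^ n) ` A) = emeasure M A"
  proof (induction n)
    case (Suc n)
    have "(\<tau> ^^ Suc n) ` A = \<tau> ` ((\<tau> ^^ n) ` A)"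
      by (simp only: funpow.simps image_comp)
    with Suc show ?case
      by (simp only: sets_image_\<tau> emeasure_image_\<tau>)
  qed (simp add: assms)
  then show "(\<tau> ^^ n) ` A \<in> sets M" "emeasure M ((\<tau> ^^ n) ` A) = emeasure M A"
    by auto
qed

section \<open>The maximal ergodic argument\<close>

lemma integrable_max_birkhoff_sum:
  assumes [simp]: "integrable M g"
  shows "integrable M (max_birkhoff_sum \<tau> g n)"
    and "integrable M (\<lambda>x. max_birkhoff_sum \<tau> g n (\<tau> x))"
proof -
  have shift: "integrable M (\<lambda>x. h (\<tau> x))" if "integrable M h" for h :: "'a \<Rightarrow> real"
    using that integrable_distr[OF measurable_transformation, of h] by (simp add: distr_\<tau>)
  show *: "integrable M (max_birkhoff_sum \<tau> g n)"
  proof (induction n)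
    case 0
    have "max_birkhoff_sum \<tau> g 0 = (\<lambda>x. 0)" by auto
    then show ?case by simp
  next
    case (Suc n)
    have "max_birkhoff_sum \<tau> g (Suc n) = (\<lambda>x. max 0 (g x + max_birkhoff_sum \<tau> g n (\<tau> x)))" by auto
    then show ?case
      using shift[OF Suc] by (auto intro!: integrable_max)
  qed
  show "integrable M (\<lambda>x. max_birkhoff_sum \<tau> g n (\<tau> x))"
    by (rule shift[OF *])
qed

text \<open>The set \<open>D\<close> where the sums are unbounded above is invariant, hence null or
  of full measure. On \<open>D\<close> the differences \<open>?h n\<close> converge to
  \<open>g\<close>, while their integrals are nonnegative by invariance of the measure; full measure
  would therefore force a nonnegative integral of \<open>g\<close>.\<close>

lemma AE_birkhoff_sum_bounded_above:
  fixes g :: "'a \<Rightarrow> real"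
  assumes g: "integrable M g" and neg: "(\<integral>x. g x \<partial>M) < 0"
  shows "AE x in M. \<exists>c::nat. \<forall>n. (\<Sum>k<n. g ((\<tau> ^^ k) x)) \<le> real c"
proof -
  let ?S = "\<lambda>n x. \<Sum>k<n. g ((\<tau> ^^ k) x)"
  let ?m = "max_birkhoff_sum \<tau> g"
  have [measurable]: "g \<in> borel_measurable M"
    using g by auto
  define D where "D = {x \<in> space M. \<forall>c::nat. \<exists>n. real c < ?S n x}"
  have D_sets: "D \<in> sets M"
    unfolding D_def by measurable
  \<comment> \<open>The sums at x and at \<tau> x differ by one step in length and by the fixed
    finite number \<open>g x\<close>, which is absorbed by changing the threshold.\<close>
  have unbounded_shift: "(\<forall>c::nat. \<exists>n. real c < ?S n (\<tau> x)) \<longleftrightarrow> (\<forall>c::nat. \<exists>n. real c < ?S n x)" for x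
  proof (intro iffI allI)
    fix c :: nat
    assume *: "\<forall>c::nat. \<exists>n. real c < ?S n (\<tau> x)"
    obtain d :: nat where "real d \<ge> real c - g x"
      using real_arch_simple by blast
    moreover obtain n where "real d < ?S n (\<tau> x)"
      using * by blast
    ultimately have "real c < ?S (Suc n) x"
      unfolding birkhoff_sum_Suc by simp
    then show "\<exists>n. real c < ?S n x" ..
  next
    fix c :: nat
    assume *: "\<forall>c::nat. \<exists>n. real c < ?S n x"
    obtain d :: nat where d: "real d \<ge> real c + g x"
      using real_arch_simple by blast
    obtain n where n: "real d < ?S n x"
      using * by blast
    \<comment> \<open>Length 0 is excluded: the empty sum is 0 and cannot exceed the natural number
      \<open>d\<close>.\<close>
    then obtain k where "n = Suc k"
      by (cases n) auto
    then have "real c < ?S k (\<tau> x)"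
      using d n unfolding \<open>n = Suc k\<close> birkhoff_sum_Suc by simp
    then show "\<exists>n. real c < ?S n (\<tau> x)" ..
  qed
  have "\<tau> -` D \<inter> space M = D"
    unfolding D_def using unbounded_shift \<tau>_space by auto
  then have "measure M D = 0 \<or> measure M D = 1"
    by (rule ergodic[OF D_sets])
  moreover have False if "measure M D = 1"
  proof -
    let ?h = "\<lambda>n x. ?m (Suc n) x - ?m n (\<tau> x)"
    have inD: "AE x in M. x \<in> D"
      using that D_sets by (simp add: prob_eq_1)
    have h: "?h n x = max (- ?m n (\<tau> x)) (g x)" for n x
      by simp
    \<comment> \<open>On \<open>D\<close> the maxima at \<tau> x eventually exceed
      \<open>- g x\<close>, so the maximum in \<open>h\<close> is attained by \<open>g x\<close> and
      the sequence is eventually constant.\<close>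
    have lim: "(\<lambda>n. ?h n x) \<longlonglongrightarrow> g x" if "x \<in> D" for x
    proof (rule tendsto_eventually)
      obtain c :: nat where c: "real c \<ge> - g x"
        using real_arch_simple by blast
      have "\<tau> x \<in> D"
        using that unbounded_shift \<tau>_space by (auto simp: D_def)
      then obtain n where n: "real c < ?S n (\<tau> x)"
        by (auto simp: D_def)
      have "?h k x = g x" if "k \<ge> n" for k
        using lift_Suc_mono_le[of "\<lambda>n. ?m n (\<tau> x)", OF max_birkhoff_sum_mono that]
          birkhoff_sum_le_max[of g \<tau> "\<tau> x" n] n c unfolding h by linarith
      then show "\<forall>\<^sub>F k in sequentially. ?h k x = g x"
        by (auto simp: eventually_sequentially)
    qed
    have "(\<lambda>n. \<integral>x. ?h n x \<partial>M) \<longlonglongrightarrow> (\<integral>x. g x \<partial>M)"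
    proof (rule integral_dominated_convergence[where w = "\<lambda>x. \<bar>g x\<bar>"])
      show "AE x in M. (\<lambda>n. ?h n x) \<longlonglongrightarrow> g x"
        using inD lim by auto
      \<comment> \<open>As the maxima are nonnegative, \<open>?h n x\<close> lies between
        \<open>g x\<close> and \<open>max 0 (g x)\<close>.\<close>
      show "AE x in M. norm (?h n x) \<le> \<bar>g x\<bar>" for n
      proof (rule AE_I2)
        fix x
        show "norm (?h n x) \<le> \<bar>g x\<bar>"
          using max_birkhoff_sum_nonneg[of \<tau> g n "\<tau> x"] unfolding h by auto
      qed
      show "(\<lambda>x. ?h n x) \<in> borel_measurable M" for n
        using integrable_max_birkhoff_sum[OF g] by (auto simp del: max_birkhoff_sum.simps)
    qed (use g in auto)
    moreover have "0 \<le> (\<integral>x. ?h n x \<partial>M)" for n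
    proof -
      have "(\<integral>x. ?m n (\<tau> x) \<partial>M) = (\<integral>x. ?m n x \<partial>M)"
        using integral_distr[OF measurable_transformation, of "?m n"] integrable_max_birkhoff_sum[OF g]
        by (auto simp: distr_\<tau>)
      also have "\<dots> \<le> (\<integral>x. ?m (Suc n) x \<partial>M)"
        by (intro integral_mono integrable_max_birkhoff_sum g max_birkhoff_sum_mono)
      finally show ?thesis
        using integrable_max_birkhoff_sum[OF g] by (simp del: max_birkhoff_sum.simps)
    qed
    ultimately have "0 \<le> (\<integral>x. g x \<partial>M)"
      by (intro LIMSEQ_le_const) auto
    with neg show False by simp
  qed
  ultimately have "measure M D = 0" by blast
  then have "AE x in M. x \<notin> D"
    using D_sets by (simp add: prob_eq_0)
  then show ?thesis
    by (rule AE_mp) (auto intro!: AE_I2 simp: D_def not_less)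
qed

text \<open>For \<open>b\<close> strictly between the mean and \<open>c\<close>, the function
  \<open>f - b\<close> has negative integral, so its Birkhoff sums stay below some \<open>d\<close>.
  The sum of \<open>f\<close> over \<open>n\<close> steps is then at most n b + d, which is at most
  n c once n is at least d / (c - b).\<close>

lemma AE_ergodic_average_eventually_le:
  fixes f :: "'a \<Rightarrow> real"
  assumes f: "integrable M f" and c: "(\<integral>x. f x \<partial>M) < c"
  shows "AE x in M. \<exists>n0. \<forall>n>n0. ergodic_average \<tau> f n x \<le> c"
proof -
  define b where "b = ((\<integral>x. f x \<partial>M) + c) / 2"
  have b: "(\<integral>x. f x \<partial>M) < b" "b < c"
    using c by (auto simp: b_def)
  have "AE x in M. \<exists>d::nat. \<forall>n. (\<Sum>k<n. f ((\<tau> ^^ k) x) - b) \<le> real d"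
    using f b by (intro AE_birkhoff_sum_bounded_above) (auto simp: prob_space)
  then show ?thesis
  proof (rule AE_mp, intro AE_I2 impI)
    fix x
    assume "\<exists>d::nat. \<forall>n. (\<Sum>k<n. f ((\<tau> ^^ k) x) - b) \<le> real d"
    then obtain d :: nat where d: "\<And>n. (\<Sum>k<n. f ((\<tau> ^^ k) x) - b) \<le> real d"
      by blast
    obtain n0 :: nat where n0: "real n0 \<ge> real d / (c - b)"
      using real_arch_simple by blast
    have "ergodic_average \<tau> f n x \<le> c" if "n > n0" for n
    proof -
      have "real d / (c - b) \<le> real n"
        using n0 that by simp
      then have "real d \<le> real n * (c - b)"
        using b by (simp add: pos_divide_le_eq)
      then have "(\<Sum>k<n. f ((\<tau> ^^ k) x)) \<le> real n * c"
        using d[of n] by (simp add: sum_subtractf algebra_simps)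
      then show ?thesis
        using that by (simp add: ergodic_average_def field_simps)
    qed
    then show "\<exists>n0. \<forall>n>n0. ergodic_average \<tau> f n x \<le> c" by blast
  qed
qed

section \<open>Measurability and measure of the towers\<close>

lemma sets_first_return_set:
  assumes [measurable]: "B \<in> sets M"
  shows "first_return_set \<tau> B N \<in> sets M"
proof -
  have "first_return_set \<tau> B N = {x \<in> space M. x \<in> B \<and> (\<tau> ^^ N) x \<in> B \<and>
      (\<forall>n\<in>{0<..<N}. (\<tau> ^^ n) x \<notin> B)}"
    using sets.sets_into_space[OF assms] by (auto simp: first_return_set_def)
  also have "\<dots> \<in> sets M"
    by measurable
  finally show ?thesis .
qed

lemma sets_tower:
  assumes "B \<in> sets M"
  shows "tower \<tau> B N \<in> sets M"
  unfolding tower_def by (intro sets.finite_UN sets_image_funpow sets_first_return_set assms) auto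

lemma emeasure_tower_le:
  assumes "B \<in> sets M"
  shows "emeasure M (tower \<tau> B N) \<le> of_nat N * emeasure M (first_return_set \<tau> B N)"
proof -
  have "emeasure M (tower \<tau> B N) \<le> (\<Sum>i<N. emeasure M ((\<tau> ^^ i) ` first_return_set \<tau> B N))"
    unfolding tower_def
    by (intro emeasure_subadditive_finite) (auto intro!: sets_image_funpow sets_first_return_set assms)
  then show ?thesis
    by (simp add: emeasure_image_funpow[OF sets_first_return_set[OF assms]])
qed

section \<open>The last exceedance time\<close>

lemma sets_last_exceedance_set:
  assumes [measurable]: "f \<in> borel_measurable M"
  shows "last_exceedance_set M \<tau> f N \<in> sets M"
  unfolding last_exceedance_set_def ergodic_average_def by measurable

text \<open>The exceedance sets are disjoint, so at most one term is nonzero and its value is the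
  last exceedance time; the default is 0 where there is no such time. As a series it integrates term
  by term to the series of the theorem.\<close>

definition last_exceedance :: "('a \<Rightarrow> real) \<Rightarrow> 'a \<Rightarrow> ennreal" where
  "last_exceedance f x = (\<Sum>N. of_nat (Suc N) * indicator (last_exceedance_set M \<tau> f (Suc N)) x)"

lemma borel_measurable_last_exceedance:
  assumes "f \<in> borel_measurable M"
  shows "last_exceedance f \<in> borel_measurable M"
  using sets_last_exceedance_set[OF assms] unfolding last_exceedance_def[abs_def] by measurable

lemma nn_integral_last_exceedance:
  assumes "f \<in> borel_measurable M"
  shows "(\<integral>\<^sup>+x. last_exceedance f x \<partial>M) =
    (\<Sum>N. of_nat (Suc N) * emeasure M (last_exceedance_set M \<tau> f (Suc N)))"
  unfolding last_exceedance_def using sets_last_exceedance_set[OF assms]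
  by (subst nn_integral_suminf) (auto simp: nn_integral_cmult_indicator simp del: of_nat_Suc)

text \<open>A positive mean lies strictly below its double, so almost every point has only finitely
  many exceedances; the last of them is no earlier than any given \<open>n\<close>.\<close>

lemma AE_last_exceedance_ge:
  fixes f :: "'a \<Rightarrow> real"
  assumes f: "integrable M f" and pos: "0 < (\<integral>x. f x \<partial>M)"
  shows "AE x in M. \<forall>n>0. ergodic_average \<tau> f n x > 2 * (\<integral>x. f x \<partial>M) \<longrightarrow>
    of_nat n \<le> last_exceedance f x"
proof -
  let ?c = "2 * (\<integral>x. f x \<partial>M)"
  have "AE x in M. \<exists>n0. \<forall>n>n0. ergodic_average \<tau> f n x \<le> ?c"
    using pos by (intro AE_ergodic_average_eventually_le f) simp
  then show ?thesis
  proof (rule AE_mp, intro AE_I2 impI allI)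
    fix x n
    assume x: "x \<in> space M" and n: "0 < n" "?c < ergodic_average \<tau> f n x"
    assume "\<exists>n0. \<forall>n>n0. ergodic_average \<tau> f n x \<le> ?c"
    then obtain n0 where n0: "\<And>n. n > n0 \<Longrightarrow> ergodic_average \<tau> f n x \<le> ?c" by blast
    define P where "P = (\<lambda>k. ?c < ergodic_average \<tau> f k x)"
    have bound: "\<forall>k. P k \<longrightarrow> k \<le> n0"
      using n0 by (force simp: P_def not_less[symmetric])
    define N where "N = (GREATEST k. P k)"
    have "P N" "n \<le> N"
      using GreatestI_nat[of P, OF _ bound[rule_format]] Greatest_le_nat[of P, OF _ bound[rule_format]] n
      by (auto simp: N_def P_def)
    moreover have "\<not> P k" if "k > N" for k
      using Greatest_le_nat[of P k, OF _ bound[rule_format]] that by (auto simp: N_def)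
    ultimately have "x \<in> last_exceedance_set M \<tau> f N"
      using x by (auto simp: last_exceedance_set_def P_def not_less)
    \<comment> \<open>The series is indexed by \<open>Suc\<close>, so the term for \<open>N\<close>
      sits at index \<open>N - 1\<close>.\<close>
    moreover obtain m where m: "N = Suc m"
      using \<open>n \<le> N\<close> n by (cases N) auto
    ultimately have "of_nat N = (\<Sum>k\<in>{m}. of_nat (Suc k) *
        indicator (last_exceedance_set M \<tau> f (Suc k)) x :: ennreal)"
      by simp
    also have "\<dots> \<le> last_exceedance f x"
      unfolding last_exceedance_def by (intro sum_le_suminf) auto
    finally show "of_nat n \<le> last_exceedance f x"
      using \<open>n \<le> N\<close> by (meson of_nat_mono order_trans)
  qed
qed

text \<open>Since 2 m(A) < 1, the average 1 over the remaining climb is an exceedance, so level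
  \<open>i\<close> contributes at least N - i times the measure of the base. Using the last
  exceedance time as a density turns summation over the levels into additivity of a measure.\<close>

lemma tower_nn_integral_last_exceedance_ge:
  assumes B: "B \<in> sets M" and A: "A \<in> sets M" "0 < measure M A" "measure M A < 1/2"
    and "tower \<tau> B N \<subseteq> A"
  shows "of_nat N * emeasure M (tower \<tau> B N) \<le>
    2 * emeasure (density M (last_exceedance (indicator A))) (tower \<tau> B N)"
proof -
  let ?L = "last_exceedance (indicator A)"
  let ?R = "\<lambda>i. (\<tau> ^^ i) ` first_return_set \<tau> B N"
  have L: "?L \<in> borel_measurable M"
    using A by (intro borel_measurable_last_exceedance) auto
  have R: "?R i \<in> sets M" for i
    by (intro sets_image_funpow sets_first_return_set B)
  have int: "(\<integral>x. indicator A x \<partial>M) = measure M A"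
    using A by simp
  have level: "of_nat (N - i) * emeasure M (first_return_set \<tau> B N) \<le> emeasure (density M ?L) (?R i)"
    if "i < N" for i
  proof -
    have "integrable M (indicator A :: 'a \<Rightarrow> real)"
      using A by (simp add: less_top[symmetric])
    from AE_last_exceedance_ge[OF this, unfolded int, OF A(2)]
    have "AE x in M. of_nat (N - i) * indicator (?R i) x \<le> ?L x * indicator (?R i) x"
    proof (rule AE_mp, intro AE_I2 impI)
      fix x
      assume *: "\<forall>n>0. ergodic_average \<tau> (indicator A) n x > 2 * measure M A \<longrightarrow> of_nat n \<le> ?L x"
      have "of_nat (N - i) \<le> ?L x" if "x \<in> ?R i"
        using that * ergodic_average_tower[OF _ \<open>i < N\<close> assms(5)] A \<open>i < N\<close> by auto
      then show "of_nat (N - i) * indicator (?R i) x \<le> ?L x * indicator (?R i) x"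
        by (auto simp: indicator_def)
    qed
    then have "(\<integral>\<^sup>+x. of_nat (N - i) * indicator (?R i) x \<partial>M) \<le> (\<integral>\<^sup>+x. ?L x * indicator (?R i) x \<partial>M)"
      by (rule nn_integral_mono_AE)
    then show ?thesis
      using R L by (simp add: nn_integral_cmult_indicator emeasure_density
          emeasure_image_funpow[OF sets_first_return_set[OF B]])
  qed
  have disj: "disjoint_family_on ?R {..<N}"
    unfolding disjoint_family_on_def
    using tower_level_unique[OF bij_transformation sets.sets_into_space[OF B]] by blast
  have "of_nat N * emeasure M (tower \<tau> B N) \<le>
      of_nat N * (of_nat N * emeasure M (first_return_set \<tau> B N))"
    by (intro mult_left_mono emeasure_tower_le B) auto
  also have "\<dots> = of_nat (N * N) * emeasure M (first_return_set \<tau> B N)"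
    by (simp add: mult.assoc)
  also have "\<dots> \<le> of_nat (2 * (\<Sum>i<N. N - i)) * emeasure M (first_return_set \<tau> B N)"
    by (intro mult_right_mono of_nat_mono sum_descending_ge) auto
  also have "\<dots> = 2 * (\<Sum>i<N. of_nat (N - i) * emeasure M (first_return_set \<tau> B N))"
    by (simp only: of_nat_mult of_nat_numeral of_nat_sum sum_distrib_right mult.assoc)
  also have "\<dots> \<le> 2 * (\<Sum>i<N. emeasure (density M ?L) (?R i))"
    using level by (intro mult_left_mono sum_mono) auto
  also have "(\<Sum>i<N. emeasure (density M ?L) (?R i)) = emeasure (density M ?L) (tower \<tau> B N)"
    unfolding tower_def by (intro sum_emeasure disj) (use R in auto)
  finally show ?thesis .
qed

lemma disjoint_towers:
  assumes "B \<in> sets M"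
  shows "disjoint_family (tower \<tau> B)"
  unfolding disjoint_family_on_def tower_def
  using tower_level_unique[OF bij_transformation sets.sets_into_space[OF assms]] by blast

end

section \<open>Choice of the set and summation over the towers\<close>

theorem theorem2p2:
  fixes M :: "'a measure" and \<tau> :: "'a \<Rightarrow> 'a"
  assumes "ergodic_system M \<tau>"
    and "has_fat_tower M \<tau>"
  shows "\<exists>A\<in>sets M.
    (\<Sum>N. of_nat (Suc N) * emeasure M (last_exceedance_set M \<tau> (indicator A) (Suc N))) = \<infinity>"
proof -
  interpret ergodic_system M \<tau> by fact
  obtain B where B: "B \<in> sets M"
    and fat: "(\<Sum>N. of_nat (Suc N) * emeasure M (tower \<tau> B (Suc N))) = \<infinity>"
    using assms(2) unfolding has_fat_tower_def by blast
  have T: "tower \<tau> B N \<in> sets M" for N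
    by (rule sets_tower[OF B])
  have disj: "disjoint_family (\<lambda>N. tower \<tau> B (h N))" if "inj h" for h :: "nat \<Rightarrow> nat"
    using disjoint_towers[OF B] that by (auto simp: disjoint_family_on_def inj_def)
  have sums: "(\<lambda>N. measure M (tower \<tau> B (h N))) sums measure M (\<Union>N. tower \<tau> B (h N))"
    if "inj h" for h :: "nat \<Rightarrow> nat"
    using T by (intro finite_measure_UNION disj that) auto
  have "summable (\<lambda>N. measure M (tower \<tau> B (Suc N)))"
    using sums[of Suc] by (auto simp: sums_iff)
  \<comment> \<open>The towers are disjoint in a probability space, so their measures are summable
    and some tail is below 1/2.\<close>
  then obtain K where K: "norm (\<Sum>N. measure M (tower \<tau> B (Suc (N + K)))) < 1/2"
    using suminf_exist_split[of "1/2" "\<lambda>N. measure M (tower \<tau> B (Suc N))"] by auto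
  define t where "t N = tower \<tau> B (Suc (N + K))" for N
  define A where "A = (\<Union>N. t N)"
  have A: "A \<in> sets M"
    using T by (auto simp: A_def t_def)
  have small: "measure M A < 1/2"
    using sums[of "\<lambda>N. Suc (N + K)"] K by (auto simp: inj_def sums_iff A_def t_def)
  \<comment> \<open>The discarded terms are finitely many and each is finite, so divergence survives
    in the tail.\<close>
  have tail: "(\<Sum>N. of_nat (Suc (N + K)) * emeasure M (t N)) = \<infinity>"
  proof -
    let ?F = "\<lambda>N. of_nat (Suc N) * emeasure M (tower \<tau> B (Suc N))"
    have "(\<Sum>N. ?F N) = (\<Sum>N. ?F (N + K)) + (\<Sum>N<K. ?F N)"
      by (rule suminf_offset) auto
    moreover have "(\<Sum>N<K. ?F N) \<noteq> \<infinity>"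
      by (simp add: ennreal_mult_eq_top_iff)
    ultimately show ?thesis
      using fat by (simp add: t_def)
  qed
  \<comment> \<open>If \<open>A\<close> were null, every term of the divergent tail would be
    0.\<close>
  have pos: "0 < measure M A"
  proof (rule ccontr)
    assume "\<not> 0 < measure M A"
    then have "emeasure M A = 0"
      by (simp add: emeasure_eq_measure zero_less_measure_iff)
    then have "emeasure M (t N) = 0" for N
      using emeasure_mono[of "t N" A M] A by (auto simp: A_def)
    with tail show False by simp
  qed
  let ?L = "last_exceedance (indicator A)"
  let ?D = "density M ?L"
  \<comment> \<open>\<open>Suc (N + K)\<close> is the height of \<open>t N\<close>, so the bound for
    a single tower applies to the tail term by term.\<close>
  have "\<infinity> \<le> (\<Sum>N. 2 * emeasure ?D (t N))"
    unfolding tail[symmetric] t_def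
    by (intro suminf_le tower_nn_integral_last_exceedance_ge A B pos small) (auto simp: A_def t_def)
  also have "\<dots> = 2 * emeasure ?D A"
    unfolding A_def using T disj[of "\<lambda>N. Suc (N + K)"]
    by (subst ennreal_suminf_cmult) (auto simp: t_def inj_def image_subset_iff intro!: arg_cong[of _ _ "(*) 2"] suminf_emeasure)
  also have "\<dots> \<le> 2 * emeasure ?D (space ?D)"
    by (intro mult_left_mono emeasure_space) auto
  also have "emeasure ?D (space ?D) = (\<integral>\<^sup>+x. ?L x \<partial>M)"
    using A by (simp add: emeasure_density borel_measurable_last_exceedance cong: nn_integral_cong)
  finally have "(\<integral>\<^sup>+x. ?L x \<partial>M) = \<infinity>"
    by (auto simp: ennreal_mult_eq_top_iff top_unique)
  then show ?thesis
    using A by (intro bexI[of _ A]) (simp add: nn_integral_last_exceedance)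
qed

end
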